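(* Let $c=(c_1,c_2,\dots,c_r)$ be an arbitrary but fixed profile with rank $r$ and level $\ell=c_1+c_2+\cdots+c_r$. Then $$f_c(0;u)=1,$$ and for $n\ge1$ $$f_c(n;u)=f_c(n-1;u)+\frac{uq^{nr}}{1-q^{nr}}\,f_c(n-1;u)+\sum_{d\ne c}\frac{uq^{n\Delta(d,c)}}{1-q^{nr}}\,f_d(n-1;u),$$ where the sum is over all profiles $d$ except for $c$ with rank $r$ and level $\ell$.
   Context: Let $r,\ell\ge1$. A profile of rank $r$ and level $\ell$ is a tuple $c=(c_1,\dots,c_r)$ of nonnegative integers with $c_1+\cdots+c_r=\ell$. A cylindric partition with profile $c$ is an $r$-tuple $\Lambda=(\lambda^{(1)},\dots,\lambda^{(r)})$ of integer partitions (weakly decreasing, positive parts, missing entries regarded as $0$) such that $\lambda^{(i)}_j\ge\lambda^{(i+1)}_{j+c_{i+1}}$ for $1\le i\le r-1$, $j\ge1$, and $\lambda^{(r)}_j\ge\lambda^{(1)}_{j+c_1}$ for $j\ge1$. $|\Lambda|$ is the sum of all parts, $\max(\Lambda)$ the largest part appearing ($0$ if $\Lambda$ is empty), and $\mathrm{st}(\Lambda)$ the number of distinct positive integers appearing as parts in $\Lambda$. For $n\ge0$, $$f_c(n;u)=\sum_{\Lambda\text{ with profile }c,\ \max(\Lambda)\le n} q^{|\Lambda|}u^{\mathrm{st}(\Lambda)},$$ a formal power series in $q$ with coefficients in $\mathbb{Z}[u]$. A slice of profile $c$ is a cylindric partition of profile $c$ with all parts equal to $1$, given by its row lengths $(n_1,\dots,n_r)$;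 its weight is $n_1+\cdots+n_r$. Its left end is governed by $c$; its right end is governed by the profile $d$ with $d_i=c_i+n_{i-1}-n_i$ for $1\le i\le r$ (with $n_0:=n_r$). For profiles $c,d$ of the same rank and level, $\Delta(d,c)$ is the smallest weight of a slice of profile $c$ whose right end is $d$, i.e. the minimum of $n_1+\cdots+n_r$ over tuples of nonnegative integers with $d_i=c_i+n_{i-1}-n_i$ for all $i$ (indices mod $r$). *)

theory Defs
  imports "HOL-Library.More_List" "HOL-Computational_Algebra.Computational_Algebra"
begin

definition profiles :: "nat \<Rightarrow> nat \<Rightarrow> nat list set" where
  "profiles r l = {c. length c = r \<and> sum_list c = l}"

definition is_partition :: "nat list \<Rightarrow> bool" where
  "is_partition p \<longleftrightarrow> sorted_wrt (\<ge>) p \<and> (\<forall>x \<in> set p. 0 < x)"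

text \<open>Rows, profile entries and parts are indexed from 0. The successor of a row is taken
  cyclically, so that the last row is compared with row 0, shifted by the profile entry 0.
  Missing entries of a partition are read as 0.\<close>

definition cylindric :: "nat list \<Rightarrow> nat list list \<Rightarrow> bool" where
  "cylindric c \<Lambda> \<longleftrightarrow>
     length \<Lambda> = length c \<and>
     (\<forall>p \<in> set \<Lambda>. is_partition p) \<and>
     (\<forall>i < length c. \<forall>j.
        nth_default 0 (\<Lambda> ! i) j
          \<ge> nth_default 0 (\<Lambda> ! (Suc i mod length c)) (j + c ! (Suc i mod length c)))"

definition parts :: "nat list list \<Rightarrow> nat set" where
  "parts \<Lambda> = set (concat \<Lambda>)"

definition weight :: "nat list list \<Rightarrow> nat" where
  "weight \<Lambda> = sum_list (concat \<Lambda>)"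

definition max_part :: "nat list list \<Rightarrow> nat" where
  "max_part \<Lambda> = Max (insert 0 (parts \<Lambda>))"

definition st :: "nat list list \<Rightarrow> nat" where
  "st \<Lambda> = card (parts \<Lambda>)"

text \<open>Power series in \<open>q\<close> over the polynomial ring in \<open>u\<close> with integer coefficients.\<close>

abbreviation q :: "int poly fps" where
  "q \<equiv> fps_X"

abbreviation u :: "int poly fps" where
  "u \<equiv> fps_const [:0, 1:]"

definition cyl_gf :: "nat list \<Rightarrow> nat \<Rightarrow> int poly fps" where
  "cyl_gf c n =
     Abs_fps (\<lambda>N. \<Sum>\<Lambda> | cylindric c \<Lambda> \<and> max_part \<Lambda> \<le> n \<and> weight \<Lambda> = N. [:0, 1:] ^ st \<Lambda>)"

definition is_slice :: "nat list \<Rightarrow> nat list list \<Rightarrow> bool" where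
  "is_slice c \<Lambda> \<longleftrightarrow> cylindric c \<Lambda> \<and> (\<forall>x \<in> parts \<Lambda>. x = 1)"

text \<open>The right end of a slice is computed from its row lengths; the equation is stated in
  the integers because subtraction on \<open>nat\<close> truncates. The index \<open>(i + length c - 1) mod length c\<close>
  is the cyclic predecessor of \<open>i\<close>.\<close>

definition right_end :: "nat list \<Rightarrow> nat list list \<Rightarrow> nat list \<Rightarrow> bool" where
  "right_end c \<Lambda> d \<longleftrightarrow>
     length d = length c \<and>
     (\<forall>i < length c.
        int (d ! i) = int (c ! i)
          + int (length (\<Lambda> ! ((i + length c - 1) mod length c))) - int (length (\<Lambda> ! i)))"

definition Delta :: "nat list \<Rightarrow> nat list \<Rightarrow> nat" where
  "Delta d c = (LEAST w. \<exists>\<Lambda>. is_slice c \<Lambda> \<and> right_end c \<Lambda> d \<and> weight \<Lambda> = w)"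

text \<open>The coefficient ring is not a field, so the reciprocal of a series with constant
  coefficient 1 is taken with the library operation for general rings, whose second argument
  is the inverse of the constant coefficient.\<close>

definition recip :: "int poly fps \<Rightarrow> int poly fps" where
  "recip g = fps_right_inverse g 1"

lemma recip_right_inverse:
  assumes "fps_nth g 0 = 1"
  shows "g * recip g = 1"
  unfolding recip_def using assms by (intro fps_right_inverse) simp

lemma recip_one_minus_q_power:
  assumes "0 < m"
  shows "(1 - q ^ m) * recip (1 - q ^ m) = 1"
  using assms by (intro recip_right_inverse) simp

lemma finite_profiles: "finite (profiles r l)"
proof (rule finite_subset)
  show "profiles r l \<subseteq> {c. set c \<subseteq> {..l} \<and> length c = r}"
    by (auto simp: profiles_def dest: member_le_sum_list)
  show "finite {c. set c \<subseteq> {..l} \<and> length c = r}"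
    by (rule finite_lists_length_eq) simp
qed

lemma finite_cylindric_weight: "finite {\<Lambda>. cylindric c \<Lambda> \<and> weight \<Lambda> = N}"
proof -
  let ?P = "{p. set p \<subseteq> {..N} \<and> length p \<le> N}"
  have len: "length p \<le> sum_list p" if "is_partition p" for p
    using that unfolding is_partition_def by (induction p) (auto simp: Suc_le_eq)
  have concat_sum: "sum_list (concat \<Lambda>) = sum_list (map sum_list \<Lambda>)" for \<Lambda> :: "nat list list"
    by (induction \<Lambda>) auto
  have "p \<in> ?P" if "cylindric c \<Lambda>" "weight \<Lambda> = N" "p \<in> set \<Lambda>" for \<Lambda> p
  proof -
    have "sum_list p \<le> sum_list (map sum_list \<Lambda>)"
      using that(3) by (intro member_le_sum_list) auto
    then have le: "sum_list p \<le> N"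
      using that(2) by (simp add: weight_def concat_sum)
    moreover have "length p \<le> sum_list p"
      using that by (intro len) (auto simp: cylindric_def)
    moreover have "x \<le> N" if "x \<in> set p" for x
      using member_le_sum_list[OF that] le by simp
    ultimately show ?thesis by auto
  qed
  then have "{\<Lambda>. cylindric c \<Lambda> \<and> weight \<Lambda> = N}
      \<subseteq> {\<Lambda>. set \<Lambda> \<subseteq> ?P \<and> length \<Lambda> = length c}"
    by (auto simp: cylindric_def)
  moreover have "finite {\<Lambda>. set \<Lambda> \<subseteq> ?P \<and> length \<Lambda> = length c}"
    by (intro finite_lists_length_eq finite_lists_length_le) simp
  ultimately show ?thesis by (rule finite_subset)
qed

text \<open>Slices are determined by their row lengths, so \<open>Delta\<close> is a minimum over tuples, and this
  minimum is taken over a nonempty set.\<close>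

lemma is_slice_imp_replicate:
  assumes "is_slice c \<Lambda>"
  shows "\<Lambda> = map (\<lambda>n. replicate n 1) (map length \<Lambda>)"
proof -
  have "p = replicate (length p) 1" if "p \<in> set \<Lambda>" for p
    using assms that by (intro replicate_eqI) (auto simp: is_slice_def parts_def)
  then show ?thesis by (simp add: map_idI)
qed

lemma weight_replicate: "weight (map (\<lambda>n. replicate n 1) ns) = sum_list ns"
  by (induction ns) (auto simp: weight_def sum_list_replicate)

lemma slice_replicate:
  assumes "length ns = length c" "length d = length c"
    and ends: "\<And>i. i < length c \<Longrightarrow>
      int (d ! i) = int (c ! i) + int (ns ! ((i + length c - 1) mod length c)) - int (ns ! i)"
  shows "is_slice c (map (\<lambda>n. replicate n 1) ns)"
    and "right_end c (map (\<lambda>n. replicate n 1) ns) d"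
proof -
  let ?r = "length c"
  have pred: "(i + ?r - 1) mod ?r < ?r" if "i < ?r" for i
    using that by (intro mod_less_divisor) auto
  have row: "nth_default 0 (replicate n (Suc 0)) j = (if j < n then 1 else 0)" for n j
    by (auto simp: nth_default_def)
  have step: "ns ! (Suc i mod ?r) \<le> ns ! i + c ! (Suc i mod ?r)" if "i < ?r" for i
  proof -
    have lt: "Suc i mod ?r < ?r"
      using that by (intro mod_less_divisor) auto
    have eq: "(Suc i mod ?r + ?r - 1) mod ?r = i"
    proof (cases "Suc i = ?r")
      case True
      then have "(Suc i mod ?r + ?r - 1) mod ?r = (?r - 1) mod ?r" by simp
      also have "\<dots> = ?r - 1" using that by (intro mod_less) simp
      also have "\<dots> = i" using True by linarith
      finally show ?thesis .
    next
      case False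
      then have "Suc i mod ?r = Suc i" using that by (intro mod_less) simp
      then show ?thesis using that by simp
    qed
    then show ?thesis using ends[OF lt, unfolded eq] by linarith
  qed
  have "cylindric c (map (\<lambda>n. replicate n 1) ns)"
    unfolding cylindric_def
  proof (intro conjI ballI allI impI)
    fix p assume "p \<in> set (map (\<lambda>n. replicate n (1::nat)) ns)"
    then show "is_partition p" by (auto simp: is_partition_def sorted_wrt_iff_nth_less)
  next
    fix i j assume i: "i < ?r"
    then have "Suc i mod ?r < ?r" by (intro mod_less_divisor) auto
    then show "nth_default 0 (map (\<lambda>n. replicate n (1::nat)) ns ! (Suc i mod ?r)) (j + c ! (Suc i mod ?r))
        \<le> nth_default 0 (map (\<lambda>n. replicate n 1) ns ! i) j"
      using i step[OF i] assms(1) by (simp add: row)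
  qed (use assms in simp)
  then show "is_slice c (map (\<lambda>n. replicate n 1) ns)"
    by (auto simp: is_slice_def parts_def)
  show "right_end c (map (\<lambda>n. replicate n 1) ns) d"
    unfolding right_end_def
  proof (intro conjI allI impI)
    fix i assume i: "i < ?r"
    show "int (d ! i) = int (c ! i)
        + int (length (map (\<lambda>n. replicate n (1::nat)) ns ! ((i + ?r - 1) mod ?r)))
        - int (length (map (\<lambda>n. replicate n (1::nat)) ns ! i))"
      using ends[OF i] i pred[OF i] assms(1) by (simp only: nth_map length_replicate)
  qed (rule assms(2))
qed

lemma Delta_eq_Least_tuples:
  assumes "length d = length c"
  shows "Delta d c = (LEAST w. \<exists>ns. length ns = length c \<and>
    (\<forall>i < length c.
       int (d ! i) = int (c ! i) + int (ns ! ((i + length c - 1) mod length c)) - int (ns ! i)) \<and>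
    sum_list ns = w)"
proof -
  let ?r = "length c"
  have "(\<exists>\<Lambda>. is_slice c \<Lambda> \<and> right_end c \<Lambda> d \<and> weight \<Lambda> = w) \<longleftrightarrow>
    (\<exists>ns. length ns = ?r \<and>
      (\<forall>i < ?r. int (d ! i) = int (c ! i) + int (ns ! ((i + ?r - 1) mod ?r)) - int (ns ! i)) \<and>
      sum_list ns = w)" (is "?L \<longleftrightarrow> ?R") for w
  proof
    assume ?L
    then obtain \<Lambda> where \<Lambda>: "is_slice c \<Lambda>" "right_end c \<Lambda> d" "weight \<Lambda> = w" by blast
    have len: "length \<Lambda> = ?r" using \<Lambda>(1) by (simp add: is_slice_def cylindric_def)
    have "(i + ?r - 1) mod ?r < ?r" if "i < ?r" for i
      using that by (intro mod_less_divisor) auto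
    then have "\<forall>i < ?r. int (d ! i) = int (c ! i)
        + int (map length \<Lambda> ! ((i + ?r - 1) mod ?r)) - int (map length \<Lambda> ! i)"
      using \<Lambda>(2) len by (simp add: right_end_def)
    moreover have "sum_list (map length \<Lambda>) = w"
      using \<Lambda>(3) is_slice_imp_replicate[OF \<Lambda>(1)] weight_replicate by metis
    ultimately show ?R using len by (intro exI[of _ "map length \<Lambda>"]) auto
  next
    assume ?R
    then show ?L using slice_replicate[OF _ assms] weight_replicate by metis
  qed
  then show ?thesis by (simp only: Delta_def)
qed

lemma slice_exists:
  assumes "c \<in> profiles r l" "d \<in> profiles r l"
  shows "\<exists>\<Lambda>. is_slice c \<Lambda> \<and> right_end c \<Lambda> d"
proof -
  have len: "length c = r" "length d = r" using assms by (auto simp: profiles_def)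
  have tot: "(\<Sum>k<r. c ! k) = l" "(\<Sum>k<r. d ! k) = l"
    using assms sum_list_sum_nth[of c] sum_list_sum_nth[of d] len
    unfolding profiles_def atLeast0LessThan by simp_all
  define h where "h i = l + (\<Sum>k\<le>i. c ! k) - (\<Sum>k\<le>i. d ! k)" for i
  have h: "int (h i) = int l + (\<Sum>k\<le>i. int (c ! k)) - (\<Sum>k\<le>i. int (d ! k))" if "i < r" for i
  proof -
    have "(\<Sum>k\<le>i. d ! k) \<le> (\<Sum>k<r. d ! k)" using that by (intro sum_mono2) auto
    then show ?thesis using tot by (simp add: h_def of_nat_diff)
  qed
  have eq: "int (d ! i) = int (c ! i) + int (h ((i + r - 1) mod r)) - int (h i)" if "i < r" for i
  proof (cases i)
    case 0
    then obtain r' where r': "r = Suc r'" using \<open>i < r\<close> by (cases r) auto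
    have "(\<Sum>k\<le>r'. c ! k) = l" "(\<Sum>k\<le>r'. d ! k) = l"
      using tot by (simp_all only: r' lessThan_Suc_atMost)
    then have "h r' = l" by (simp add: h_def)
    then show ?thesis using 0 h[of 0] r' by simp
  next
    case (Suc k)
    then show ?thesis using that h[of i] h[of k] by simp
  qed
  have "int (d ! i) = int (c ! i)
      + int (map h [0..<r] ! ((i + length c - 1) mod length c)) - int (map h [0..<r] ! i)"
    if "i < length c" for i
  proof -
    have "(i + r - 1) mod r < r" using that len by (intro mod_less_divisor) auto
    then show ?thesis using eq[of i] that len by simp
  qed
  from slice_replicate[OF _ _ this] len show ?thesis by auto
qed

end

theory Submission imports Defs begin

text \<open>Stripping all parts equal to \<open>n\<close> from a cylindric partition of profile \<open>c\<close> with maximal part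
  \<open>n\<close> removes a nonempty slice and leaves a cylindric partition with maximal part below \<open>n\<close>, whose
  profile is the right end \<open>d\<close> of the slice; any slice from \<open>c\<close> to \<open>d\<close> can be put back.
  The slices from \<open>c\<close> to \<open>d\<close> are obtained from the smallest one by adding the same number \<open>k\<close> to all
  \<open>r\<close> row lengths, since two of them satisfy the same cyclic difference equations. Summing the weights
  over \<open>k\<close> gives a geometric series with ratio \<open>q ^ (n * r)\<close>. For \<open>d = c\<close> the smallest slice is
  empty, so the smallest nonempty one has weight \<open>r\<close>.\<close>

section \<open>Slices between two profiles\<close>

text \<open>The row lengths \<open>ns\<close> describe a slice of profile \<open>c\<close> with right end \<open>d\<close>; indexing by the cyclic
  successor and moving terms across the equation avoids subtraction.\<close>

definition slice_rows :: "nat list \<Rightarrow> nat list \<Rightarrow> nat list \<Rightarrow> bool" where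
  "slice_rows c ns d \<longleftrightarrow> length ns = length c \<and> length d = length c \<and>
     (\<forall>i < length c. d ! (Suc i mod length c) + ns ! (Suc i mod length c)
        = c ! (Suc i mod length c) + ns ! i)"

section \<open>Cyclic indices and the link with \<open>right_end\<close>\<close>

lemma pred_Suc_mod:
  assumes "i < r"
  shows "(Suc i mod r + r - 1) mod r = i"
proof (cases "Suc i = r")
  case False
  then have "Suc i mod r = Suc i" using assms by simp
  then show ?thesis using assms by simp
qed auto

lemma Suc_pred_mod:
  fixes i r :: nat
  assumes "i < r"
  shows "Suc ((i + r - 1) mod r) mod r = i"
proof -
  have "Suc ((i + r - 1) mod r) mod r = Suc (i + r - 1) mod r" by (simp add: mod_Suc_eq)
  also have "Suc (i + r - 1) = i + r" using assms by simp
  finally show ?thesis using assms by simp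
qed

text \<open>Cyclic successor and predecessor are mutually inverse on the indices below
  \<open>r\<close>. This converts the predecessor indexing of \<open>right_end\<close> into the
  successor indexing of \<open>cylindric\<close>.\<close>

lemma all_cyclic_pred_iff:
  fixes r :: nat
  shows "(\<forall>i<r. P i ((i + r - 1) mod r)) \<longleftrightarrow> (\<forall>i<r. P (Suc i mod r) i)"
proof (intro iffI allI impI)
  fix i assume *: "\<forall>i<r. P i ((i + r - 1) mod r)" and i: "i < r"
  then have "Suc i mod r < r" by (intro mod_less_divisor) auto
  with * show "P (Suc i mod r) i" using pred_Suc_mod[OF i] by metis
next
  fix i assume *: "\<forall>i<r. P (Suc i mod r) i" and i: "i < r"
  then have "(i + r - 1) mod r < r" by (intro mod_less_divisor) auto
  with * show "P i ((i + r - 1) mod r)" using Suc_pred_mod[OF i] by metis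
qed

lemma slice_rows_iff:
  assumes "length d = length c"
  shows "slice_rows c ns d \<longleftrightarrow> length ns = length c \<and>
    (\<forall>i < length c.
       int (d ! i) = int (c ! i) + int (ns ! ((i + length c - 1) mod length c)) - int (ns ! i))"
proof -
  have eq: "int a = int b + int x - int y \<longleftrightarrow> a + y = b + x" for a b x y
    by linarith
  show ?thesis
    unfolding slice_rows_def eq using assms
      all_cyclic_pred_iff[of "length c" "\<lambda>i j. d ! i + ns ! i = c ! i + ns ! j"] by simp
qed

lemma Delta_eq_Least_slice_rows:
  assumes "length d = length c"
  shows "Delta d c = (LEAST w. \<exists>ns. slice_rows c ns d \<and> sum_list ns = w)"
  unfolding Delta_eq_Least_tuples[OF assms] slice_rows_iff[OF assms] by (simp add: conj_assoc)

lemma slice_rows_exists: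
  assumes "c \<in> profiles r l" "d \<in> profiles r l"
  shows "\<exists>ns. slice_rows c ns d"
proof -
  obtain \<Lambda> where \<Lambda>: "is_slice c \<Lambda>" "right_end c \<Lambda> d" using slice_exists[OF assms] by blast
  have len: "length \<Lambda> = length c" "length d = length c"
    using \<Lambda> by (auto simp: is_slice_def cylindric_def right_end_def)
  have "(i + length c - 1) mod length c < length c" if "i < length c" for i
    using that by (intro mod_less_divisor) auto
  then have "slice_rows c (map length \<Lambda>) d"
    using \<Lambda>(2) len by (simp add: slice_rows_iff right_end_def)
  then show ?thesis ..
qed

text \<open>Each index is the successor of its predecessor, so some equation determines each entry
  of the right end.\<close>

lemma slice_rows_unique_right_end:
  assumes "slice_rows c ns d" "slice_rows c ns d'"
  shows "d = d'"
proof (rule nth_equalityI)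
  show "length d = length d'" using assms by (simp add: slice_rows_def)
  fix i assume "i < length d"
  then have i: "i < length c" using assms by (simp add: slice_rows_def)
  then have "(i + length c - 1) mod length c < length c" by (intro mod_less_divisor) auto
  then have "d ! i + ns ! i = d' ! i + ns ! i"
    using assms Suc_pred_mod[OF i] unfolding slice_rows_def by metis
  then show "d ! i = d' ! i" by simp
qed

text \<open>Summed once around the cycle, the row lengths cancel, so the level is preserved.\<close>

lemma slice_rows_in_profiles:
  assumes "slice_rows c ns d" "c \<in> profiles r l"
  shows "d \<in> profiles r l"
proof -
  have len: "length ns = r" "length c = r" "length d = r"
    using assms by (auto simp: slice_rows_def profiles_def)
  have sum: "sum_list xs = (\<Sum>i<r. xs ! (Suc i mod r))" if "length xs = r" for xs :: "nat list"
  proof -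
    \<comment> \<open>Rotation by one place realises the successor index without changing the
      sum.\<close>
    have "sum_list xs = sum_list (rotate1 xs)" by (cases xs) auto
    also have "\<dots> = (\<Sum>i<r. rotate1 xs ! i)"
      using that by (simp add: sum_list_sum_nth atLeast0LessThan)
    finally show ?thesis using that by (simp add: nth_rotate1)
  qed
  have "sum_list d + sum_list ns
      = (\<Sum>i<r. d ! (Suc i mod r) + ns ! (Suc i mod r))"
    using sum len by (simp add: sum.distrib)
  also have "\<dots> = (\<Sum>i<r. c ! (Suc i mod r) + ns ! i)"
    using assms(1) len by (intro sum.cong) (auto simp: slice_rows_def)
  also have "\<dots> = sum_list c + sum_list ns"
    using sum len by (simp add: sum.distrib sum_list_sum_nth[of ns] atLeast0LessThan)
  finally show ?thesis using assms(2) len by (simp add: profiles_def)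
qed

section \<open>Uniform shifts and the smallest nonempty slice\<close>

lemma slice_rows_shift:
  assumes "slice_rows c ns d"
  shows "slice_rows c (map ((+) k) ns) d"
proof -
  have "Suc i mod length c < length c" if "i < length c" for i
    using that by (intro mod_less_divisor) auto
  then show ?thesis using assms by (simp add: slice_rows_def)
qed

lemma sum_list_shift: "sum_list (map ((+) k) ns) = sum_list ns + length ns * k"
  for k :: nat
  by (induction ns) auto

text \<open>Comparing the equations for \<open>ns\<close> and \<open>ms\<close> eliminates
  \<open>c\<close> and \<open>d\<close>, so the difference of the row lengths agrees at neighbouring
  rows and propagates from row 0. The additive form avoids truncated subtraction.\<close>

lemma slice_rows_diff_const:
  assumes "slice_rows c ns d" "slice_rows c ms d" "i < length c"
  shows "ns ! i + ms ! 0 = ms ! i + ns ! 0"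
  using assms(3)
proof (induction i)
  case (Suc i)
  then have "Suc i mod length c = Suc i" "i < length c" by auto
  then have "d ! Suc i + ns ! Suc i = c ! Suc i + ns ! i" "d ! Suc i + ms ! Suc i = c ! Suc i + ms ! i"
    using assms(1,2) unfolding slice_rows_def by metis+
  then show ?case using Suc by simp
qed simp

text \<open>The difference of two such slices is constant over the rows, and comparing total weights
  fixes its sign.\<close>

lemma slice_rows_shift_of_smaller:
  assumes "slice_rows c ns d" "slice_rows c ms d" "sum_list ms \<le> sum_list ns"
  shows "\<exists>k. ns = map ((+) k) ms"
proof -
  have len: "length ns = length c" "length ms = length c" using assms by (auto simp: slice_rows_def)
  note diff = slice_rows_diff_const[OF assms(1,2)]
  show ?thesis
  proof (cases "ms ! 0 \<le> ns ! 0")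
    case True
    then have "ns = map ((+) (ns ! 0 - ms ! 0)) ms"
      using diff len by (intro nth_equalityI) force+
    then show ?thesis ..
  next
    case False
    \<comment> \<open>A negative difference would make every row of \<open>ns\<close> shorter, hence
      the total strictly smaller, unless there are no rows at all.\<close>
    have "c = []"
    proof (rule ccontr)
      assume "c \<noteq> []"
      have "sum_list ns < sum_list ms"
        unfolding sum_list_sum_nth len
      proof (rule sum_strict_mono)
        show "ns ! i < ms ! i" if "i \<in> {0..<length c}" for i
          using diff[of i] that False by simp
      qed (use \<open>c \<noteq> []\<close> in auto)
      with assms(3) show False by simp
    qed
    then show ?thesis using len by simp
  qed
qed

lemma slice_rows_self: "slice_rows c (replicate (length c) k) c"
proof -
  have "Suc i mod length c < length c" if "i < length c" for i
    using that by (intro mod_less_divisor) auto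
  then show ?thesis by (simp add: slice_rows_def)
qed

text \<open>Used contrapositively: for \<open>d\<close> different from \<open>c\<close>, even the
  smallest slice is nonempty.\<close>

lemma slice_rows_empty:
  assumes "slice_rows c ns d" "sum_list ns = 0"
  shows "d = c"
proof -
  have "ns = replicate (length c) 0"
    using assms by (intro replicate_eqI) (auto simp: slice_rows_def)
  then show ?thesis using assms(1) slice_rows_self slice_rows_unique_right_end by metis
qed

text \<open>Provides one base slice for both kinds of terms in the recurrence, so that the later
  counting by shifts \<open>k\<close> needs no case distinction on \<open>d = c\<close>.\<close>

lemma smallest_nonempty_slice:
  assumes "0 < r" "c \<in> profiles r l" "d \<in> profiles r l"
  obtains b where "slice_rows c b d" "sum_list b = (if d = c then r else Delta d c)"
    "0 < sum_list b" "\<And>ns. slice_rows c ns d \<Longrightarrow> 0 < sum_list ns \<Longrightarrow> \<exists>k. ns = map ((+) k) b"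
proof -
  have len: "length c = r" "length d = r" using assms by (auto simp: profiles_def)
  show thesis
  proof (cases "d = c")
    case True
    let ?b = "replicate r (1 :: nat)"
    have sl: "slice_rows c (replicate r k) d" for k
      using slice_rows_self[of c k] len True by simp
    have sum: "sum_list ?b = r" by (simp add: sum_list_replicate)
    have "sum_list ?b \<le> sum_list ns" if ns: "slice_rows c ns d" "0 < sum_list ns" for ns
    proof -
      \<comment> \<open>Comparison with the empty slice shows that all rows of \<open>ns\<close>
        have the same length \<open>k\<close>; positive weight then forces \<open>k\<close> to be at
        least 1.\<close>
      obtain k where k: "ns = map ((+) k) (replicate r 0)"
        using slice_rows_shift_of_smaller[OF ns(1) sl[of 0]] by (auto simp: sum_list_replicate)
      then have "sum_list ns = r * k" by (simp add: sum_list_replicate)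
      with ns(2) show ?thesis using sum by (cases k) auto
    qed
    then have "\<exists>k. ns = map ((+) k) ?b" if "slice_rows c ns d" "0 < sum_list ns" for ns
      using slice_rows_shift_of_smaller[OF that(1) sl[of 1]] that by blast
    then show ?thesis
      using that[OF sl[of 1]] sum True assms(1) by simp
  next
    case False
    let ?P = "\<lambda>w. \<exists>ns. slice_rows c ns d \<and> sum_list ns = w"
    have D: "Delta d c = (LEAST w. ?P w)" using len by (intro Delta_eq_Least_slice_rows) simp
    have "\<exists>w. ?P w" using slice_rows_exists[OF assms(2,3)] by blast
    then have "?P (Delta d c)" unfolding D by (rule LeastI_ex)
    then obtain b where b: "slice_rows c b d" "sum_list b = Delta d c" by blast
    have "sum_list b \<le> sum_list ns" if "slice_rows c ns d" for ns
      unfolding b(2) D using that by (intro Least_le) blast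
    then have "\<exists>k. ns = map ((+) k) b" if "slice_rows c ns d" for ns
      using slice_rows_shift_of_smaller that b(1) by blast
    moreover have "0 < sum_list b" using slice_rows_empty b(1) False by blast
    ultimately show ?thesis using that[of b] b False by auto
  qed
qed

section \<open>Adding and removing the largest parts\<close>

text \<open>The inverse of stripping the parts equal to \<open>n\<close>, when the parts of
  \<open>M\<close> are below \<open>n\<close>.\<close>

definition add_top :: "nat \<Rightarrow> nat list \<Rightarrow> nat list list \<Rightarrow> nat list list" where
  "add_top n ns M = map2 (\<lambda>k p. replicate k n @ p) ns M"

lemma max_part_le_iff: "max_part \<Lambda> \<le> n \<longleftrightarrow> (\<forall>p \<in> set \<Lambda>. \<forall>x \<in> set p. x \<le> n)"
  by (auto simp: max_part_def parts_def)

lemma length_add_top [simp]: "length (add_top n ns M) = min (length ns) (length M)"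
  by (simp add: add_top_def)

lemma nth_add_top:
  "i < length ns \<Longrightarrow> i < length M \<Longrightarrow> add_top n ns M ! i = replicate (ns ! i) n @ M ! i"
  by (simp add: add_top_def)

lemma weight_add_top:
  "length ns = length M \<Longrightarrow> weight (add_top n ns M) = n * sum_list ns + weight M"
  unfolding add_top_def weight_def
  by (induction ns M rule: list_induct2) (auto simp: sum_list_replicate algebra_simps)

lemma parts_add_top:
  "length ns = length M \<Longrightarrow>
     parts (add_top n ns M) = (if sum_list ns = 0 then {} else {n}) \<union> parts M"
  unfolding add_top_def parts_def
  by (induction ns M rule: list_induct2) auto

lemma takeWhile_add_top:
  assumes "\<forall>x \<in> set p. x < (n :: nat)"
  shows "takeWhile ((=) n) (replicate k n @ p) = replicate k n"
    and "dropWhile ((=) n) (replicate k n @ p) = p"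
  using assms by (induction k) (auto simp: takeWhile_eq_Nil_iff dropWhile_eq_self_iff)

text \<open>Since all parts of \<open>M\<close> are below \<open>n\<close>, the leading run of
  \<open>n\<close> in each row recovers \<open>ns\<close> and the remainder recovers
  \<open>M\<close>.\<close>

lemma add_top_inject:
  assumes "length ns = length M" "length ns' = length M'"
    and "\<forall>p \<in> set M. \<forall>x \<in> set p. x < n" "\<forall>p \<in> set M'. \<forall>x \<in> set p. x < n"
    and eq: "add_top n ns M = add_top n ns' M'"
  shows "ns = ns'" "M = M'"
proof -
  have "map (length \<circ> takeWhile ((=) n)) (add_top n ns M) = ns
      \<and> map (dropWhile ((=) n)) (add_top n ns M) = M"
    if "length ns = length M" "\<forall>p \<in> set M. \<forall>x \<in> set p. x < n" for ns M
    using that unfolding add_top_def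
    by (induction ns M rule: list_induct2) (auto simp: takeWhile_add_top)
  then show "ns = ns'" "M = M'" using assms by metis+
qed

text \<open>In a weakly decreasing row bounded by \<open>n\<close>, the copies of \<open>n\<close>
  form an initial run.\<close>

lemma split_top_row:
  assumes "is_partition p" "\<forall>x \<in> set p. x \<le> n"
  obtains k p' where "p = replicate k n @ p'" "is_partition p'" "\<forall>x \<in> set p'. x < n"
proof -
  have "takeWhile ((=) n) p = replicate (length (takeWhile ((=) n) p)) n"
    by (rule replicate_eqI) (auto dest: set_takeWhileD)
  then have "p = replicate (length (takeWhile ((=) n) p)) n @ dropWhile ((=) n) p"
    using takeWhile_dropWhile_id[of "(=) n" p] by simp
  moreover have "is_partition (dropWhile ((=) n) p) \<and> (\<forall>x \<in> set (dropWhile ((=) n) p). x < n)"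
    using assms
  proof (induction p)
    \<comment> \<open>A first entry other than \<open>n\<close> is below \<open>n\<close> and bounds
      all later entries.\<close>
    case (Cons a p)
    then show ?case by (cases "a = n") (auto simp: is_partition_def)
  qed (simp add: is_partition_def)
  ultimately show thesis using that by blast
qed

lemma is_partition_Cons:
  "is_partition (a # p) \<longleftrightarrow> is_partition p \<and> 0 < a \<and> (\<forall>x \<in> set p. x \<le> a)"
  by (auto simp: is_partition_def)

lemma is_partition_add_top:
  assumes "is_partition p" "\<forall>x \<in> set p. x < n" "0 < n"
  shows "is_partition (replicate k n @ p)"
proof (induction k)
  case (Suc k)
  have "\<forall>x \<in> set (replicate k n @ p). x \<le> n" using assms(2) by (auto simp: less_imp_le)
  then show ?case
    unfolding replicate_Suc append_Cons is_partition_Cons using Suc assms(3) by blast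
qed (use assms(1) in simp)

text \<open>Beyond the end of the row both sides are the default 0, so row comparisons need no range
  conditions.\<close>

lemma nth_default_add_top:
  "nth_default 0 (replicate k n @ p) j = (if j < k then n else nth_default 0 p (j - k))"
  by (auto simp: nth_default_append nth_default_def nth_append)

lemma nth_default_less:
  "\<forall>x \<in> set p. x < n \<Longrightarrow> 0 < n \<Longrightarrow> nth_default 0 p j < (n :: nat)"
  by (auto simp: nth_default_def)

text \<open>In a column inside the top run of row \<open>i\<close> the larger side is
  \<open>n\<close>, which bounds everything. Past that run, the slice equation places the compared
  entry past its own top run, and the inequality becomes one for \<open>M\<close> with profile
  \<open>d\<close>.\<close>

lemma cylindric_add_top:
  assumes "cylindric d M" "slice_rows c ns d" "0 < n" and less: "\<forall>p \<in> set M. \<forall>x \<in> set p. x < n"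
  shows "cylindric c (add_top n ns M)"
proof -
  let ?r = "length c"
  have len: "length ns = ?r" "length d = ?r" "length M = ?r"
    using assms(1,2) by (auto simp: cylindric_def slice_rows_def)
  have row: "add_top n ns M ! i = replicate (ns ! i) n @ M ! i" if "i < ?r" for i
    using that len by (simp add: nth_add_top)
  have "is_partition p" if p: "p \<in> set (add_top n ns M)" for p
  proof -
    obtain i where i: "i < ?r" "p = replicate (ns ! i) n @ M ! i"
      using p row len by (auto simp: in_set_conv_nth)
    have "M ! i \<in> set M" using i len by simp
    then show ?thesis
      unfolding i(2) using less assms(1,3) by (intro is_partition_add_top) (auto simp: cylindric_def)
  qed
  moreover have "nth_default 0 (add_top n ns M ! (Suc i mod ?r)) (j + c ! (Suc i mod ?r))
      \<le> nth_default 0 (add_top n ns M ! i) j" if i: "i < ?r" for i j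
  proof -
    define i' where "i' = Suc i mod ?r"
    have i': "i' < ?r" unfolding i'_def using i by (intro mod_less_divisor) auto
    have sl: "d ! i' + ns ! i' = c ! i' + ns ! i"
      using assms(2) i by (simp add: slice_rows_def i'_def)
    have "M ! i' \<in> set M" using i' len by simp
    then have lt: "nth_default 0 (M ! i') k < n" for k using less assms(3) by (intro nth_default_less) auto
    have "nth_default 0 (M ! i') (k + d ! i') \<le> nth_default 0 (M ! i) k" for k
      using assms(1) i len by (simp add: cylindric_def i'_def)
    \<comment> \<open>Stripping moves the two compared rows by different amounts; the slice equation
      says that this changes the offset from \<open>c ! i'\<close> to \<open>d ! i'\<close>.\<close>
    from this[of "j - ns ! i"] have "nth_default 0 (M ! i') (j + c ! i' - ns ! i')
        \<le> nth_default 0 (M ! i) (j - ns ! i)" if "ns ! i \<le> j"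
    proof -
      have "j - ns ! i + d ! i' = j + c ! i' - ns ! i'" using sl that by linarith
      then show ?thesis using \<open>nth_default 0 (M ! i') (j - ns ! i + d ! i') \<le> _\<close> by simp
    qed
    then show ?thesis
      unfolding i'_def[symmetric] row[OF i] row[OF i'] nth_default_add_top
      using lt[of "j + c ! i' - ns ! i'"] sl by auto
  qed
  ultimately show ?thesis using len by (simp add: cylindric_def)
qed

text \<open>The lengths of the top runs define both the slice and its right end. Cylindricity keeps
  the entries of this right end nonnegative, and reading its inequalities past the top runs gives
  those for \<open>M\<close>.\<close>

lemma cylindric_remove_top:
  assumes "cylindric c \<Lambda>" "max_part \<Lambda> \<le> n" "0 < n"
  obtains ns d M where "\<Lambda> = add_top n ns M" "slice_rows c ns d" "cylindric d M"
    "\<forall>p \<in> set M. \<forall>x \<in> set p. x < n"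
proof -
  let ?r = "length c"
  have len: "length \<Lambda> = ?r" using assms(1) by (simp add: cylindric_def)
  have "\<exists>k p'. \<Lambda> ! i = replicate k n @ p' \<and> is_partition p' \<and> (\<forall>x \<in> set p'. x < n)"
    if "i < ?r" for i
  proof -
    have "\<Lambda> ! i \<in> set \<Lambda>" using that len by simp
    then have "is_partition (\<Lambda> ! i)" "\<forall>x \<in> set (\<Lambda> ! i). x \<le> n"
      using assms(1,2) by (auto simp: cylindric_def max_part_le_iff)
    then show ?thesis by (meson split_top_row)
  qed
  then obtain k p where kp: "\<And>i. i < ?r \<Longrightarrow> \<Lambda> ! i = replicate (k i) n @ p i"
    "\<And>i. i < ?r \<Longrightarrow> is_partition (p i)" "\<And>i. i < ?r \<Longrightarrow> \<forall>x \<in> set (p i). x < n"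
    by metis
  define ns M where "ns = map k [0..<?r]" and "M = map p [0..<?r]"
  \<comment> \<open>The right-end equation solved for \<open>d\<close>; the bound \<open>le\<close>
    below shows that the subtraction does not truncate.\<close>
  define d where "d = map (\<lambda>i. c ! i + k ((i + ?r - 1) mod ?r) - k i) [0..<?r]"
  have \<Lambda>: "\<Lambda> = add_top n ns M"
    using kp(1) len by (intro nth_equalityI) (auto simp: nth_add_top ns_def M_def)
  have cyl: "nth_default 0 (replicate (k (Suc i mod ?r)) n @ p (Suc i mod ?r)) (j + c ! (Suc i mod ?r))
      \<le> nth_default 0 (replicate (k i) n @ p i) j" if "i < ?r" for i j
  proof -
    have i': "Suc i mod ?r < ?r" using that by (intro mod_less_divisor) auto
    show ?thesis
      unfolding kp(1)[OF that, symmetric] kp(1)[OF i', symmetric]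
      using assms(1) that by (simp add: cylindric_def)
  qed
  \<comment> \<open>Otherwise, at column \<open>k i\<close>, the successor row would still read
    \<open>n\<close> at the shifted position, while row \<open>i\<close> has already dropped below
    \<open>n\<close>.\<close>
  have le: "k (Suc i mod ?r) \<le> c ! (Suc i mod ?r) + k i" if "i < ?r" for i
  proof (rule ccontr)
    assume "\<not> ?thesis"
    then have "n \<le> nth_default 0 (p i) 0" using cyl[OF that, of "k i"]
      by (simp add: nth_default_add_top split: if_splits)
    moreover have "nth_default 0 (p i) 0 < n" using kp(3)[OF that] assms(3) by (rule nth_default_less)
    ultimately show False by simp
  qed
  have d: "d ! (Suc i mod ?r) + k (Suc i mod ?r) = c ! (Suc i mod ?r) + k i" if "i < ?r" for i
  proof -
    have "Suc i mod ?r < ?r" using that by (intro mod_less_divisor) auto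
    moreover have "d ! j = c ! j + k ((j + ?r - 1) mod ?r) - k j" if "j < ?r" for j
      using that by (simp add: d_def)
    ultimately have "d ! (Suc i mod ?r) = c ! (Suc i mod ?r) + k i - k (Suc i mod ?r)"
      using pred_Suc_mod[OF that] by metis
    then show ?thesis using le[OF that] by simp
  qed
  have "slice_rows c ns d"
    unfolding slice_rows_def
  proof (intro conjI allI impI)
    fix i assume i: "i < ?r"
    then have "Suc i mod ?r < ?r" by (intro mod_less_divisor) auto
    then show "d ! (Suc i mod ?r) + ns ! (Suc i mod ?r) = c ! (Suc i mod ?r) + ns ! i"
      using d[OF i] i by (simp add: ns_def)
  qed (simp_all add: ns_def d_def)
  moreover have "cylindric d M"
    unfolding cylindric_def
  proof (intro conjI ballI allI impI)
    show "length M = length d" by (simp add: M_def d_def)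
    show "is_partition p" if "p \<in> set M" for p using that kp(2) by (auto simp: M_def)
    fix i j assume "i < length d"
    moreover have ld: "length d = ?r" by (simp add: d_def)
    ultimately have i: "i < ?r" by simp
    then have i': "Suc i mod ?r < ?r" by (intro mod_less_divisor) auto
    have "nth_default 0 (p (Suc i mod ?r)) (j + d ! (Suc i mod ?r)) \<le> nth_default 0 (p i) j"
    proof -
      \<comment> \<open>Column \<open>j\<close> of the stripped row \<open>i\<close> is column
        \<open>j + k i\<close> of the original, where both lookups lie past their top runs.\<close>
      have "j + k i + c ! (Suc i mod ?r) - k (Suc i mod ?r) = j + d ! (Suc i mod ?r)"
        "\<not> j + k i + c ! (Suc i mod ?r) < k (Suc i mod ?r)"
        using d[OF i] by simp_all
      then show ?thesis using cyl[OF i, of "j + k i"] by (simp add: nth_default_add_top)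
    qed
    then show "nth_default 0 (M ! (Suc i mod length d)) (j + d ! (Suc i mod length d))
        \<le> nth_default 0 (M ! i) j"
      unfolding ld using i i' by (simp add: M_def)
  qed
  moreover have "\<forall>p \<in> set M. \<forall>x \<in> set p. x < n" using kp(3) by (auto simp: M_def)
  ultimately show thesis by (rule that[OF \<Lambda>])
qed

section \<open>Generating functions\<close>

definition cyl_set :: "nat list \<Rightarrow> nat \<Rightarrow> nat \<Rightarrow> nat list list set" where
  "cyl_set c n N = {\<Lambda>. cylindric c \<Lambda> \<and> max_part \<Lambda> \<le> n \<and> weight \<Lambda> = N}"

lemma cyl_gf_nth: "cyl_gf c n $ N = (\<Sum>\<Lambda> \<in> cyl_set c n N. [:0, 1:] ^ st \<Lambda>)"
  by (simp add: cyl_gf_def cyl_set_def)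

lemma finite_cyl_set [simp]: "finite (cyl_set c n N)"
  by (rule finite_subset[OF _ finite_cylindric_weight[of c N]]) (auto simp: cyl_set_def)

text \<open>The recurrence for single coefficients, with the geometric series expanded over the
  shift \<open>k\<close>. A partition containing the part \<open>Suc n\<close> is encoded uniquely
  by a right end \<open>d\<close>, a shift \<open>k\<close> and a remainder \<open>M\<close>. The
  bound by \<open>N\<close> makes each sum finite and each subtraction exact.\<close>

lemma cyl_gf_nth_Suc:
  assumes r: "0 < r" and c: "c \<in> profiles r l"
  defines "D \<equiv> \<lambda>d. if d = c then r else Delta d c"
  shows "cyl_gf c (Suc n) $ N = cyl_gf c n $ N + (\<Sum>d \<in> profiles r l.
    \<Sum>k | Suc n * D d + Suc n * r * k \<le> N.
      [:0, 1:] * cyl_gf d n $ (N - (Suc n * D d + Suc n * r * k)))"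
proof -
  have len: "length c = r" using c by (simp add: profiles_def)
  have "\<exists>b. slice_rows c b d \<and> sum_list b = D d \<and> 0 < sum_list b \<and>
      (\<forall>ns. slice_rows c ns d \<longrightarrow> 0 < sum_list ns \<longrightarrow> (\<exists>k. ns = map ((+) k) b))"
    if "d \<in> profiles r l" for d
    unfolding D_def using smallest_nonempty_slice[OF r c that] by metis
  then obtain b where b: "\<And>d. d \<in> profiles r l \<Longrightarrow> slice_rows c (b d) d"
    "\<And>d. d \<in> profiles r l \<Longrightarrow> sum_list (b d) = D d"
    "\<And>d. d \<in> profiles r l \<Longrightarrow> 0 < sum_list (b d)"
    "\<And>d ns. d \<in> profiles r l \<Longrightarrow> slice_rows c ns d \<Longrightarrow> 0 < sum_list ns \<Longrightarrow> \<exists>k. ns = map ((+) k) (b d)"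
    by metis
  define w where "w d k = Suc n * D d + Suc n * r * k" for d k
  \<comment> \<open>\<open>T\<close> is the set of codes of partitions of weight \<open>N\<close> in
    which \<open>Suc n\<close> occurs, \<open>w d k\<close> is the weight carried by those top
    parts, and \<open>g\<close> decodes.\<close>
  define T where "T = (SIGMA d : profiles r l. SIGMA k : {k. w d k \<le> N}. cyl_set d n (N - w d k))"
  define g where "g = (\<lambda>(d, k, M). add_top (Suc n) (map ((+) k) (b d)) M)"
  have fin: "finite {k. w d k \<le> N}" for d
  proof (rule finite_subset)
    show "{k. w d k \<le> N} \<subseteq> {..N}"
    proof
      fix k assume "k \<in> {k. w d k \<le> N}"
      then have "w d k \<le> N" by simp
      moreover have "k \<le> Suc n * r * k" using r by simp
      then have "k \<le> w d k" unfolding w_def by (rule trans_le_add2)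
      ultimately show "k \<in> {..N}" by simp
    qed
  qed simp
  have rows: "slice_rows c (map ((+) k) (b d)) d" "length (map ((+) k) (b d)) = r"
    "Suc n * sum_list (map ((+) k) (b d)) = w d k" "0 < sum_list (map ((+) k) (b d))"
    if d: "d \<in> profiles r l" for d k
  proof -
    have lb: "length (b d) = r" using b(1)[OF d] len by (simp add: slice_rows_def)
    show "slice_rows c (map ((+) k) (b d)) d" using b(1)[OF d] by (rule slice_rows_shift)
    show "length (map ((+) k) (b d)) = r" using lb by simp
    show "Suc n * sum_list (map ((+) k) (b d)) = w d k"
      using b(2)[OF d] lb by (simp add: sum_list_shift w_def algebra_simps)
    show "0 < sum_list (map ((+) k) (b d))"
      unfolding sum_list_shift using b(3)[OF d] by simp
  qed
  have rest: "length M = r" "\<forall>p \<in> set M. \<forall>x \<in> set p. x < Suc n" "cylindric d M" "weight M = N'"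
    if "d \<in> profiles r l" "M \<in> cyl_set d n N'" for d M N'
    using that by (auto simp: cyl_set_def max_part_le_iff cylindric_def profiles_def less_Suc_eq_le)
  have inj: "inj_on g T"
  proof (rule inj_onI)
    fix x y assume "x \<in> T" "y \<in> T" "g x = g y"
    moreover obtain d k M d' k' M' where xy: "x = (d, k, M)" "y = (d', k', M')"
      by (cases x, cases y) auto
    ultimately have T: "d \<in> profiles r l" "d' \<in> profiles r l"
      "M \<in> cyl_set d n (N - w d k)" "M' \<in> cyl_set d' n (N - w d' k')"
      and eq: "add_top (Suc n) (map ((+) k) (b d)) M = add_top (Suc n) (map ((+) k') (b d')) M'"
      by (auto simp: T_def g_def)
    have "length (map ((+) k) (b d)) = length M" "length (map ((+) k') (b d')) = length M'"
      using rows(2) rest(1) T by metis+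
    from add_top_inject[OF this rest(2)[OF T(1,3)] rest(2)[OF T(2,4)] eq]
    have ns: "map ((+) k) (b d) = map ((+) k') (b d')" and M: "M = M'" .
    \<comment> \<open>The common row lengths form a slice from \<open>c\<close> whose right end is
      both \<open>d\<close> and \<open>d'\<close>.\<close>
    have d: "d = d'" using ns rows(1) T slice_rows_unique_right_end by metis
    \<comment> \<open>With \<open>d\<close> settled the base slices coincide, and since
      \<open>r\<close> is positive there is a first row in which to compare the shifts.\<close>
    moreover have "k = k'"
      using ns rows(2)[OF T(1), of k] r unfolding d by (cases "b d'") auto
    ultimately show "x = y" using xy M by simp
  qed
  have g: "cylindric c (g x)" "weight (g x) = N" "parts (g x) = insert (Suc n) (parts (snd (snd x)))"
    "\<forall>y \<in> parts (snd (snd x)). y \<le> n" if "x \<in> T" for x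
  proof -
    obtain d k M where x: "x = (d, k, M)" by (cases x)
    have T: "d \<in> profiles r l" "w d k \<le> N" "M \<in> cyl_set d n (N - w d k)"
      using that by (auto simp: T_def x)
    have gx: "g x = add_top (Suc n) (map ((+) k) (b d)) M" by (simp add: g_def x)
    have l: "length (map ((+) k) (b d)) = length M" using rows(2) rest(1) T by metis
    show "cylindric c (g x)"
      unfolding gx by (rule cylindric_add_top[OF rest(3)[OF T(1,3)] rows(1)[OF T(1)] _ rest(2)[OF T(1,3)]]) simp
    show "weight (g x) = N"
      unfolding gx weight_add_top[OF l] rows(3)[OF T(1)] rest(4)[OF T(1,3)] using T(2) by simp
    show "parts (g x) = insert (Suc n) (parts (snd (snd x)))"
      unfolding gx parts_add_top[OF l] if_not_P[OF gr_implies_not0[OF rows(4)[OF T(1)]]]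
      by (simp add: x)
    show "\<forall>y \<in> parts (snd (snd x)). y \<le> n"
      using rest(2)[OF T(1,3)] by (auto simp: x parts_def less_Suc_eq_le)
  qed
  \<comment> \<open>The value \<open>Suc n\<close> is new and counts once, however many copies are
    added; this is the single factor of \<open>u\<close>.\<close>
  have st: "st (g x) = Suc (st (snd (snd x)))" if "x \<in> T" for x
  proof -
    have "finite (parts (snd (snd x)))" by (simp add: parts_def)
    moreover have "Suc n \<notin> parts (snd (snd x))" using g(4)[OF that] by auto
    ultimately show ?thesis by (simp add: st_def g(3)[OF that])
  qed
  have split: "cyl_set c (Suc n) N = cyl_set c n N \<union> g ` T"
  proof (intro subset_antisym subsetI)
    fix \<Lambda> assume "\<Lambda> \<in> cyl_set c (Suc n) N"
    then have \<Lambda>: "cylindric c \<Lambda>" "max_part \<Lambda> \<le> Suc n" "weight \<Lambda> = N" by (auto simp: cyl_set_def)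
    obtain ns d M where dec: "\<Lambda> = add_top (Suc n) ns M" "slice_rows c ns d" "cylindric d M"
      "\<forall>p \<in> set M. \<forall>x \<in> set p. x < Suc n"
      using cylindric_remove_top[OF \<Lambda>(1,2) zero_less_Suc] .
    have d: "d \<in> profiles r l" using slice_rows_in_profiles[OF dec(2) c] .
    have l: "length ns = length M" using dec by (simp add: slice_rows_def cylindric_def)
    show "\<Lambda> \<in> cyl_set c n N \<union> g ` T"
    proof (cases "sum_list ns = 0")
      \<comment> \<open>An empty top slice means that no part equals \<open>Suc n\<close>.\<close>
      case True
      then have "parts \<Lambda> = parts M" using parts_add_top[OF l] dec(1) by simp
      then have "max_part \<Lambda> \<le> n"
        using dec(4) by (auto simp: max_part_def parts_def less_Suc_eq_le)
      then show ?thesis using \<Lambda> by (simp add: cyl_set_def)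
    next
      case False
      then have "0 < sum_list ns" by (rule neq0_conv[THEN iffD1])
      then obtain k where k: "ns = map ((+) k) (b d)" using b(4)[OF d dec(2)] by blast
      have "w d k + weight M = N"
        using \<Lambda>(3) weight_add_top[OF l, of "Suc n"] rows(3)[OF d, of k] unfolding dec(1) k by metis
      then have "(d, k, M) \<in> T"
        using d dec by (auto simp: T_def cyl_set_def max_part_le_iff less_Suc_eq_le)
      moreover have "\<Lambda> = g (d, k, M)" using dec(1) k by (simp add: g_def)
      ultimately show ?thesis by blast
    qed
  next
    fix \<Lambda> assume "\<Lambda> \<in> cyl_set c n N \<union> g ` T"
    then show "\<Lambda> \<in> cyl_set c (Suc n) N"
    proof
      assume "\<Lambda> \<in> g ` T"
      then obtain x where x: "x \<in> T" "\<Lambda> = g x" by blast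
      have "\<forall>y \<in> parts (g x). y \<le> Suc n" using g(4)[OF x(1)] by (auto simp: g(3)[OF x(1)])
      then have "max_part (g x) \<le> Suc n" by (simp add: max_part_le_iff parts_def)
      then show ?thesis using g(1,2)[OF x(1)] x(2) by (simp add: cyl_set_def)
    qed (auto simp: cyl_set_def)
  qed
  \<comment> \<open>Occurrence of the part \<open>Suc n\<close> separates the two sets.\<close>
  have disj: "cyl_set c n N \<inter> g ` T = {}"
  proof -
    have "Suc n \<notin> parts \<Lambda>" if "\<Lambda> \<in> cyl_set c n N" for \<Lambda>
      using that by (fastforce simp: cyl_set_def max_part_le_iff parts_def)
    moreover have "Suc n \<in> parts (g x)" if "x \<in> T" for x using g(3)[OF that] by simp
    ultimately show ?thesis by blast
  qed
  have finT: "finite T"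
    unfolding T_def using fin by (auto intro!: finite_SigmaI finite_profiles)
  have "cyl_gf c (Suc n) $ N = cyl_gf c n $ N + (\<Sum>\<Lambda> \<in> g ` T. [:0, 1:] ^ st \<Lambda>)"
    unfolding cyl_gf_nth split by (rule sum.union_disjoint) (use finT disj in auto)
  also have "(\<Sum>\<Lambda> \<in> g ` T. [:0, 1:] ^ st \<Lambda>)
      = (\<Sum>x \<in> T. [:0, 1:] * [:0, 1:] ^ st (snd (snd x)) :: int poly)"
    unfolding sum.reindex[OF inj] comp_def by (rule sum.cong) (simp_all only: st power_Suc)
  also have "\<dots> = (\<Sum>d \<in> profiles r l. \<Sum>k | w d k \<le> N. \<Sum>M \<in> cyl_set d n (N - w d k).
      [:0, 1:] * [:0, 1:] ^ st M)"
    unfolding T_def using fin finite_profiles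
    by (simp add: sum.Sigma split_def)
  also have "\<dots> = (\<Sum>d \<in> profiles r l. \<Sum>k | w d k \<le> N. [:0, 1:] * cyl_gf d n $ (N - w d k))"
    by (simp only: cyl_gf_nth sum_distrib_left)
  finally show ?thesis unfolding w_def .
qed

section \<open>Coefficients of the geometric series\<close>

lemma recip_one_minus_q_power_nth:
  assumes "0 < m"
  shows "recip (1 - q ^ m) $ j = (if m dvd j then 1 else 0)"
proof -
  define E :: "int poly fps" where "E = Abs_fps (\<lambda>j. if m dvd j then 1 else 0)"
  have "(1 - q ^ m) * E = 1"
  proof (rule fps_ext)
    fix j
    have "((1 - q ^ m) * E) $ j = E $ j - (q ^ m * E) $ j" by (simp add: left_diff_distrib)
    \<comment> \<open>Multiplication by \<open>q ^ m\<close> moves the indicator of the multiples of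
      \<open>m\<close> up by \<open>m\<close>, so everything cancels except at 0.\<close>
    also have "\<dots> = (1 :: int poly fps) $ j"
      using assms by (auto simp: fps_X_power_mult_nth E_def dvd_minus_self dest: dvd_imp_le)
    finally show "((1 - q ^ m) * E) $ j = (1 :: int poly fps) $ j" .
  qed
  \<comment> \<open>Both \<open>recip (1 - q ^ m)\<close> and \<open>E\<close> are inverses of
    \<open>1 - q ^ m\<close>, and inverses in a commutative ring are unique.\<close>
  then have "recip (1 - q ^ m) = recip (1 - q ^ m) * ((1 - q ^ m) * E)" by simp
  also have "\<dots> = ((1 - q ^ m) * recip (1 - q ^ m)) * E" by (simp only: mult_ac)
  finally have "recip (1 - q ^ m) = E" unfolding recip_one_minus_q_power[OF assms] by simp
  then show ?thesis by (simp add: E_def)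
qed

text \<open>Puts a term of the recurrence into the shape of the inner sum of
  \<open>cyl_gf_nth_Suc\<close>: only multiples of \<open>m\<close> contribute to the convolution,
  indexed by their quotient \<open>k\<close>.\<close>

lemma geometric_mult_nth:
  assumes "0 < m"
  shows "(u * q ^ a * recip (1 - q ^ m) * f) $ N
    = (\<Sum>k | a + m * k \<le> N. [:0, 1:] * f $ (N - (a + m * k)))"
proof -
  have eq: "(recip (1 - q ^ m) * f) $ L = (\<Sum>k | m * k \<le> L. f $ (L - m * k))" for L
  proof -
    have "(recip (1 - q ^ m) * f) $ L = (\<Sum>i = 0..L. if m dvd i then f $ (L - i) else 0)"
      unfolding fps_mult_nth recip_one_minus_q_power_nth[OF assms] by (intro sum.cong) auto
    also have "\<dots> = (\<Sum>i \<in> {i \<in> {0..L}. m dvd i}. f $ (L - i))"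
      by (rule sum.inter_filter[symmetric]) simp
    also have "{i \<in> {0..L}. m dvd i} = (*) m ` {k. m * k \<le> L}" by (auto simp: dvd_def)
    also have "(\<Sum>i \<in> \<dots>. f $ (L - i)) = (\<Sum>k | m * k \<le> L. f $ (L - m * k))"
      using assms by (subst sum.reindex) (auto simp: inj_on_def)
    finally show ?thesis .
  qed
  have "(u * q ^ a * recip (1 - q ^ m) * f) $ N = [:0, 1:] * (q ^ a * (recip (1 - q ^ m) * f)) $ N"
    unfolding mult.assoc by (rule fps_mult_left_const_nth)
  also have "(q ^ a * (recip (1 - q ^ m) * f)) $ N = (\<Sum>k | a + m * k \<le> N. f $ (N - (a + m * k)))"
  \<comment> \<open>For \<open>N < a\<close> the coefficient vanishes and no \<open>k\<close> is
    admissible; otherwise the truncated \<open>N - a\<close> is exact.\<close>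
  proof (cases "N < a")
    case False
    then have "{k. m * k \<le> N - a} = {k. a + m * k \<le> N}" by auto
    then show ?thesis using False by (simp add: fps_X_power_mult_nth eq)
  qed (simp add: fps_X_power_mult_nth)
  finally show ?thesis by (simp only: sum_distrib_left)
qed

text \<open>Parts are positive, so the bound 0 leaves only the tuple of empty rows, of weight 0 and
  with no part values.\<close>

lemma cyl_gf_0: "cyl_gf c 0 = 1"
proof (rule fps_ext)
  fix N
  let ?E = "replicate (length c) ([] :: nat list)"
  have "\<Lambda> = ?E" if "cylindric c \<Lambda>" "max_part \<Lambda> \<le> 0" for \<Lambda>
  proof (rule replicate_eqI)
    fix p assume "p \<in> set \<Lambda>"
    then have "\<forall>x \<in> set p. 0 < x" "\<forall>x \<in> set p. x \<le> 0"
      using that unfolding max_part_le_iff by (auto simp: cylindric_def is_partition_def)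
    then show "p = []" by (cases p) auto
  qed (use that in \<open>simp add: cylindric_def\<close>)
  moreover have "cylindric c ?E"
  proof -
    have "Suc i mod length c < length c" if "i < length c" for i
      using that by (intro mod_less_divisor) auto
    then show ?thesis by (simp add: cylindric_def is_partition_def)
  qed
  moreover have "weight ?E = 0" "parts ?E = {}" by (auto simp: weight_def parts_def)
  moreover have "max_part ?E = 0" using \<open>parts ?E = {}\<close> by (simp add: max_part_def)
  ultimately have "\<Lambda> \<in> cyl_set c 0 N \<longleftrightarrow> N = 0 \<and> \<Lambda> = ?E" for \<Lambda>
    unfolding cyl_set_def mem_Collect_eq by (metis le_refl)
  then have "cyl_set c 0 N = (if N = 0 then {?E} else {})" by auto
  then show "cyl_gf c 0 $ N = (1 :: int poly fps) $ N"
    using \<open>parts ?E = {}\<close> by (simp add: cyl_gf_nth st_def)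
qed

theorem theorem14:
  fixes r l :: nat and c :: "nat list"
  assumes "r \<ge> 1" and "l \<ge> 1" and "c \<in> profiles r l"
  shows "cyl_gf c 0 = 1 \<and>
    (\<forall>n\<ge>1. cyl_gf c n =
       cyl_gf c (n - 1)
       + u * q ^ (n * r) * recip (1 - q ^ (n * r)) * cyl_gf c (n - 1)
       + (\<Sum>d \<in> profiles r l - {c}.
            u * q ^ (n * Delta d c) * recip (1 - q ^ (n * r)) * cyl_gf d (n - 1)))"
proof (intro conjI allI impI cyl_gf_0)
  fix n :: nat assume "n \<ge> 1"
  then obtain m where n: "n = Suc m" by (cases n) auto
  \<comment> \<open>The value \<open>r\<close> at \<open>d = c\<close> is the weight of the smallest
    nonempty slice from \<open>c\<close> to itself. One sum over all profiles then covers both kinds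
    of terms, and splitting off \<open>d = c\<close> yields the separate middle term.\<close>
  define D where "D d = (if d = c then r else Delta d c)" for d
  define F where "F d = u * q ^ (n * D d) * recip (1 - q ^ (n * r)) * cyl_gf d m" for d
  have r: "0 < r" "0 < n * r" using assms(1) n by simp_all
  have "cyl_gf c n = cyl_gf c m + (\<Sum>d \<in> profiles r l. F d)"
  proof (rule fps_ext)
    fix N
    show "cyl_gf c n $ N = (cyl_gf c m + (\<Sum>d \<in> profiles r l. F d)) $ N"
      unfolding fps_add_nth fps_sum_nth F_def geometric_mult_nth[OF r(2)]
      unfolding n D_def by (rule cyl_gf_nth_Suc[OF r(1) assms(3)])
  qed
  also have "(\<Sum>d \<in> profiles r l. F d) = F c + (\<Sum>d \<in> profiles r l - {c}. F d)"
    using assms(3) finite_profiles by (intro sum.remove)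
  also have "(\<Sum>d \<in> profiles r l - {c}. F d) = (\<Sum>d \<in> profiles r l - {c}.
      u * q ^ (n * Delta d c) * recip (1 - q ^ (n * r)) * cyl_gf d m)"
    by (intro sum.cong) (auto simp: F_def D_def)
  finally show "cyl_gf c n = cyl_gf c (n - 1)
      + u * q ^ (n * r) * recip (1 - q ^ (n * r)) * cyl_gf c (n - 1)
      + (\<Sum>d \<in> profiles r l - {c}.
           u * q ^ (n * Delta d c) * recip (1 - q ^ (n * r)) * cyl_gf d (n - 1))"
    unfolding F_def[of c] D_def[of c] by (simp add: n add.assoc)
qed

end
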